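(* Let $u,v\in S_n$ with $u\leq v$ in Bruhat order, and let $t=(i\,j)$ be inversion-minimal on $(u,v)$. Then $$R_{u,v}(q)=q\,R_{ut,vt}(q)+(q-1)\,R_{u,vt}(q).$$
   Context: $S_n$ carries the (strong) Bruhat order $\leq$. A permutation $w$ is written in one-line notation with $w_i=w(i)$, and $w(i\,k)$ is obtained from $w$ by swapping the entries in positions $i$ and $k$. For $u,v\in S_n$, a transposition $(i\,k)$ with $i<k$ is called inversion-minimal on $(u,v)$ if $v_i>v_k$ and $u_i<u_k$, and the interval $[i,k]$ is minimal with respect to inclusion with this property, i.e. there is no proper subinterval $[p,q]\subsetneq[i,k]$, $p<q$, with $v_p>v_q$ and $u_p<u_q$. Let $D_R(w)=\{s \text{ simple reflection}: \ell(ws)<\ell(w)\}$ be the right descent set. The $R$-polynomials are the unique family $\{R_{u,v}(q)\}_{u,v\in S_n}\subset\mathbb{Z}[q]$ such that: $R_{u,v}=0$ if $u\not\leq v$; $R_{u,v}=1$ if $u=v$; and for $s\in D_R(v)$, $R_{u,v}=R_{us,vs}$ if $s\in D_R(u)$, while $R_{u,v}=qR_{us,vs}+(q-1)R_{u,vs}$ if $s\notin D_R(u)$. *)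

theory Defs
  imports "HOL-Combinatorics.Permutations" "HOL-Computational_Algebra.Polynomial"
begin

(* S_n is the set of functions w :: nat => nat with "w permutes {1..n}". The product of S_n is
   composition, so w \<circ> transpose i k is w with the entries in positions i and k swapped. *)

definition perm_length :: "nat \<Rightarrow> (nat \<Rightarrow> nat) \<Rightarrow> nat" where
  "perm_length n w = card {(i, k). 1 \<le> i \<and> i < k \<and> k \<le> n \<and> w i > w k}"

definition simple_reflections :: "nat \<Rightarrow> (nat \<Rightarrow> nat) set" where
  "simple_reflections n = {transpose i (i + 1) |i. 1 \<le> i \<and> i < n}"

definition transpositions :: "nat \<Rightarrow> (nat \<Rightarrow> nat) set" where
  "transpositions n = {transpose i k |i k. 1 \<le> i \<and> i < k \<and> k \<le> n}"

definition bruhat_step :: "nat \<Rightarrow> (nat \<Rightarrow> nat) \<Rightarrow> (nat \<Rightarrow> nat) \<Rightarrow> bool" where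
  "bruhat_step n u v \<longleftrightarrow>
     (\<exists>t\<in>transpositions n. v = u \<circ> t \<and> perm_length n u < perm_length n v)"

(* Only meaningful for u and v in S_n. *)
definition bruhat_le :: "nat \<Rightarrow> (nat \<Rightarrow> nat) \<Rightarrow> (nat \<Rightarrow> nat) \<Rightarrow> bool" where
  "bruhat_le n = (bruhat_step n)\<^sup>*\<^sup>*"

definition right_descents :: "nat \<Rightarrow> (nat \<Rightarrow> nat) \<Rightarrow> (nat \<Rightarrow> nat) set" where
  "right_descents n w = {s \<in> simple_reflections n. perm_length n (w \<circ> s) < perm_length n w}"

definition inversion_minimal ::
  "nat \<Rightarrow> (nat \<Rightarrow> nat) \<Rightarrow> (nat \<Rightarrow> nat) \<Rightarrow> nat \<Rightarrow> nat \<Rightarrow> bool" where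
  "inversion_minimal n u v i k \<longleftrightarrow>
     1 \<le> i \<and> i < k \<and> k \<le> n \<and> v i > v k \<and> u i < u k \<and>
     \<not> (\<exists>p q. p < q \<and> {p..q} \<subset> {i..k} \<and> v p > v q \<and> u p < u q)"

(* The polynomial variable q. *)
abbreviation qvar :: "int poly" where
  "qvar \<equiv> [:0, 1:]"

definition is_R_family ::
  "nat \<Rightarrow> ((nat \<Rightarrow> nat) \<Rightarrow> (nat \<Rightarrow> nat) \<Rightarrow> int poly) \<Rightarrow> bool" where
  "is_R_family n R \<longleftrightarrow>
     (\<forall>u v. u permutes {1..n} \<longrightarrow> v permutes {1..n} \<longrightarrow>
        (\<not> bruhat_le n u v \<longrightarrow> R u v = 0) \<and>
        (u = v \<longrightarrow> R u v = 1) \<and>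
        (\<forall>s \<in> right_descents n v.
           (s \<in> right_descents n u \<longrightarrow> R u v = R (u \<circ> s) (v \<circ> s)) \<and>
           (s \<notin> right_descents n u \<longrightarrow>
              R u v = qvar * R (u \<circ> s) (v \<circ> s) + (qvar - 1) * R u (v \<circ> s))))"

(* The family is unique only on S_n x S_n, as is_R_family leaves R unconstrained on other
   functions nat => nat; hence the description is applied to the value at (u, v), not to R. *)
definition R_poly :: "nat \<Rightarrow> (nat \<Rightarrow> nat) \<Rightarrow> (nat \<Rightarrow> nat) \<Rightarrow> int poly" where
  "R_poly n u v = (THE p. \<exists>R. is_R_family n R \<and> R u v = p)"

end

theory Submission
  imports Defs
begin

text \<open>
  When \<open>j = i + 1\<close>, the transposition \<open>t\<close> is a simple reflection that is a right descent of
  \<open>v\<close> but not of \<open>u\<close>, and the claimed identity is the defining recursion of the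
  \<open>R\<close>-polynomials. The general case is reduced to this one by moving the left end of the
  interval inwards.

  Suppose \<open>i + 1 < j\<close> and put \<open>s = (i i+1)\<close>. Minimality, applied to the intervals
  \<open>[i, i+1]\<close> and \<open>[i+1, j]\<close>, leaves two possibilities: the entries in position \<open>i + 1\<close> of
  \<open>u\<close> and \<open>v\<close> are both smaller, or both larger, than the two entries of the same
  permutation in positions \<open>i\<close> and \<open>j\<close> (\<open>inversion_minimal_same_order\<close>). Since \<open>t\<close> exchanges
  just those two entries, \<open>s\<close> is a right descent of all four of \<open>u\<close>, \<open>v\<close>, \<open>ut\<close>,
  \<open>vt\<close> or of none of them. An \<open>R\<close>-polynomial does not change when both arguments are
  multiplied by a simple reflection that is a descent of both or of neither
  (\<open>R_poly_comp_adj\<close>), so each of the three polynomials in the identity may be replaced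
  by the one with both arguments multiplied by \<open>s\<close>. As \<open>t s = s (i+1 j)\<close>, this is the identity
  for \<open>us\<close>, \<open>vs\<close> and \<open>(i+1 j)\<close>, and \<open>(i+1 j)\<close> is inversion-minimal on \<open>(us, vs)\<close>.
  Induction on \<open>j - i\<close> finishes the argument.

  Most of the work is to show that the \<open>R\<close>-polynomials are well defined, that is, that a family
  with the defining properties exists and is unique on permutations. Uniqueness is an induction on
  the length of \<open>v\<close>. For existence, the recursion is read as an operator \<open>M_s\<close>, here
  \<open>hecke_op\<close>, which sends the function \<open>R(-, vs)\<close> to \<open>R(-, v)\<close>. Always
  using the first descent of \<open>v\<close> defines a function \<open>R_col\<close>; that every other
  descent gives the same result follows, by induction on the length of \<open>v\<close>, from the commutation
  and braid relations of the operators. In the symmetric group, where descents and lengths can be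
  read off the one-line notation, these relations are a matter of comparing a few entries of \<open>u\<close>.
\<close>

section \<open>Length and transpositions\<close>

abbreviation adj :: "nat \<Rightarrow> nat \<Rightarrow> nat" where
  "adj i \<equiv> transpose i (Suc i)"

text \<open>The pair \<open>(i, Suc i)\<close> is the only one whose order an adjacent transposition reverses. Both the
  effect of a simple reflection on inversions and its effect on Bruhat steps come from this.\<close>

lemma adj_less_mono:
  assumes "a < b" and "(a, b) \<noteq> (i, Suc i)"
  shows "adj i a < adj i b"
  using assms by (auto simp: transpose_def)

lemma adj_cancel [simp]: "w \<circ> adj i \<circ> adj i = w"
  by (simp add: comp_assoc)

lemma comp_adj_at [simp]:
  "(w \<circ> adj i) i = w (Suc i)" "(w \<circ> adj i) (Suc i) = w i"
  "(w \<circ> adj (Suc i)) i = w i" "(w \<circ> adj i) (Suc (Suc i)) = w (Suc (Suc i))"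
  by (simp_all add: transpose_def)

lemma adj_range:
  assumes "1 \<le> i" "i < n" "1 \<le> a" "a \<le> n"
  shows "1 \<le> adj i a" "adj i a \<le> n"
  using assms by (auto simp: transpose_def)

lemma inj_comp_transpose:
  assumes "inj w"
  shows "inj (w \<circ> transpose a b)"
  using assms by (intro inj_compose inj_on_transpose)

lemma transpose_permutes:
  fixes w :: "nat \<Rightarrow> nat"
  assumes "w permutes {1..n}" "1 \<le> i" "i \<le> n" "1 \<le> k" "k \<le> n"
  shows "w \<circ> transpose i k permutes {1..n}"
  using assms by (intro permutes_compose permutes_swap_id) auto

lemma adj_permutes:
  assumes "w permutes {1..n}" "1 \<le> i" "i < n"
  shows "w \<circ> adj i permutes {1..n}"
  using assms by (intro transpose_permutes) auto

text \<open>The adjacent transposition maps the inversions of \<open>w\<close> bijectively to those inversions of the new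
  permutation that differ from \<open>(i, Suc i)\<close>.\<close>

lemma perm_length_comp_adj:
  assumes "1 \<le> i" "i < n" "w i < w (Suc i)"
  shows "perm_length n (w \<circ> adj i) = Suc (perm_length n w)"
proof -
  define Inv where "Inv = (\<lambda>w::nat\<Rightarrow>nat. {(a, b). 1 \<le> a \<and> a < b \<and> b \<le> n \<and> w a > w b})"
  have "Inv (w \<circ> adj i) = insert (i, Suc i) (map_prod (adj i) (adj i) ` Inv w)"
  proof (intro equalityI subsetI)
    fix x assume "x \<in> Inv (w \<circ> adj i)"
    then obtain a b where x: "x = (a, b)" and ab: "1 \<le> a" "a < b" "b \<le> n" "w (adj i a) > w (adj i b)"
      by (auto simp: Inv_def)
    show "x \<in> insert (i, Suc i) (map_prod (adj i) (adj i) ` Inv w)"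
    proof (cases "(a, b) = (i, Suc i)")
      case False
      then have "(adj i a, adj i b) \<in> Inv w"
        using adj_less_mono[OF ab(2) False] adj_range[OF assms(1,2), of a]
          adj_range[OF assms(1,2), of b] ab by (auto simp: Inv_def)
      then have "map_prod (adj i) (adj i) (adj i a, adj i b) \<in> map_prod (adj i) (adj i) ` Inv w"
        by (rule imageI)
      then show ?thesis by (simp add: x)
    qed (simp add: x)
  next
    fix x assume "x \<in> insert (i, Suc i) (map_prod (adj i) (adj i) ` Inv w)"
    then consider "x = (i, Suc i)" | a b where "x = (adj i a, adj i b)" "(a, b) \<in> Inv w"
      by auto
    then show "x \<in> Inv (w \<circ> adj i)"
    proof cases
      case 1
      then show ?thesis using assms by (auto simp: Inv_def)
    next
      case (2 a b)
      then have ab: "1 \<le> a" "a < b" "b \<le> n" "w a > w b" by (auto simp: Inv_def)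
      then have "(a, b) \<noteq> (i, Suc i)" using assms by auto
      from adj_less_mono[OF ab(2) this] show ?thesis
        using adj_range[OF assms(1,2), of a] adj_range[OF assms(1,2), of b] ab 2(1)
        by (auto simp: Inv_def)
    qed
  qed
  moreover have "(i, Suc i) \<notin> map_prod (adj i) (adj i) ` Inv w"
  proof
    assume "(i, Suc i) \<in> map_prod (adj i) (adj i) ` Inv w"
    then obtain a b where "i = adj i a" "Suc i = adj i b" "a < b"
      unfolding Inv_def by auto
    then show False by (auto simp: transpose_def split: if_splits)
  qed
  moreover have "finite (Inv w)"
    by (rule finite_subset[of _ "{1..n} \<times> {1..n}"]) (auto simp: Inv_def)
  moreover have "inj_on (map_prod (adj i) (adj i)) (Inv w)"
    by (rule inj_on_subset[OF prod.inj_map]) (simp_all add: inj_swap)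
  ultimately have "card (Inv (w \<circ> adj i)) = Suc (card (Inv w))"
    by (simp add: card_image)
  then show ?thesis by (simp add: perm_length_def Inv_def)
qed

lemma perm_length_comp_adj_down:
  assumes "1 \<le> i" "i < n" "w (Suc i) < w i"
  shows "perm_length n w = Suc (perm_length n (w \<circ> adj i))"
  using perm_length_comp_adj[of i n "w \<circ> adj i"] assms by simp

text \<open>Induction on \<open>k - i\<close>, with \<open>(i k) = s (i+1 k) s\<close> for \<open>s = (i i+1)\<close>. Each of the two factors
  \<open>s\<close> changes the length by one, and which way is decided by comparing \<open>w (Suc i)\<close> with \<open>w i\<close> and
  with \<open>w k\<close>. The two changes either cancel or both increase the length, or they decrease it by two
  in total; this last case would need \<open>w k < w (Suc i) < w i\<close> and is excluded by \<open>w i < w k\<close>.\<close>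

lemma perm_length_less_comp_transpose:
  assumes "inj w" "1 \<le> i" "i < k" "k \<le> n" "w i < w k"
  shows "perm_length n w < perm_length n (w \<circ> transpose i k)"
  using assms
proof (induction "k - i" arbitrary: i w)
  case 0
  then show ?case by simp
next
  case (Suc d)
  show ?case
  proof (cases "k = Suc i")
    case True
    then show ?thesis using Suc.prems perm_length_comp_adj[of i n w] by simp
  next
    case False
    let ?x = "w \<circ> adj i" and ?y = "w \<circ> adj i \<circ> transpose (Suc i) k"
    have i: "1 \<le> i" "i < n" "Suc i < k" using Suc.prems False by auto
    have wt: "w \<circ> transpose i k = ?y \<circ> adj i"
      using i by (auto simp: fun_eq_iff transpose_def)
    have lt: "perm_length n ?x < perm_length n ?y"
    proof (rule Suc.hyps(1))
      show "inj ?x" using Suc.prems(1) by (simp add: inj_compose)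
      show "?x (Suc i) < ?x k" using i Suc.prems by (simp add: transpose_def)
    qed (use Suc.hyps(2) Suc.prems i in auto)
    have y: "?y i = w (Suc i)" "?y (Suc i) = w k" using i by (auto simp: transpose_def)
    have ne: "w (Suc i) \<noteq> w i" "w (Suc i) \<noteq> w k"
      using i Suc.prems(1) by (simp_all add: inj_eq)
    consider "w (Suc i) < w i" | "w i < w (Suc i)" "w (Suc i) < w k" | "w k < w (Suc i)"
      using ne Suc.prems by linarith
    then show ?thesis
    proof cases
      case 1
      then show ?thesis
        using lt perm_length_comp_adj_down[OF i(1,2) 1] perm_length_comp_adj[OF i(1,2), of ?y]
          Suc.prems(5) y wt by simp
    next
      case 2
      then show ?thesis
        using lt perm_length_comp_adj[OF i(1,2) 2(1)] perm_length_comp_adj[OF i(1,2), of ?y] y wt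
        by simp
    next
      case 3
      then show ?thesis
        using lt perm_length_comp_adj[OF i(1,2), of w] perm_length_comp_adj_down[OF i(1,2), of ?y]
          Suc.prems(5) y wt by simp
    qed
  qed
qed

lemma perm_length_less_comp_transpose_iff:
  assumes "inj w" "1 \<le> i" "i < k" "k \<le> n"
  shows "perm_length n w < perm_length n (w \<circ> transpose i k) \<longleftrightarrow> w i < w k"
proof
  assume *: "perm_length n w < perm_length n (w \<circ> transpose i k)"
  show "w i < w k"
  proof (rule ccontr)
    assume "\<not> w i < w k"
    moreover have "w i \<noteq> w k" using assms by (simp add: inj_eq)
    ultimately have "(w \<circ> transpose i k) i < (w \<circ> transpose i k) k" by simp
    from perm_length_less_comp_transpose[where w = "w \<circ> transpose i k",
        OF inj_comp_transpose[OF assms(1)] assms(2-4) this] *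
    show False by (simp add: comp_assoc)
  qed
qed (use perm_length_less_comp_transpose assms in blast)

lemma perm_length_eq_0:
  assumes "\<And>i. 1 \<le> i \<Longrightarrow> i < n \<Longrightarrow> w i < w (Suc i)"
  shows "perm_length n w = 0"
proof -
  have "w a < w b" if "a < b" "1 \<le> a" "b \<le> n" for a b
    using that
  proof (induction b)
    case (Suc b)
    then show ?case using assms[of b] by (cases "a = b") auto
  qed simp
  then have "{(i, k). 1 \<le> i \<and> i < k \<and> k \<le> n \<and> w i > w k} = {}"
    by (auto dest: order_less_asym)
  then show ?thesis unfolding perm_length_def by (simp only: card.empty)
qed

lemma adj_mem_right_descents:
  assumes "w permutes {1..n}" "1 \<le> i" "i < n"
  shows "adj i \<in> right_descents n w \<longleftrightarrow> w (Suc i) < w i"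
proof -
  have "adj i \<in> simple_reflections n"
    using assms(2,3) unfolding simple_reflections_def by auto
  moreover have "perm_length n (w \<circ> adj i) < perm_length n w \<longleftrightarrow> w (Suc i) < w i"
    using perm_length_less_comp_transpose_iff[of "w \<circ> adj i" i "Suc i" n] assms(2,3)
      inj_comp_transpose[OF permutes_inj[OF assms(1)]] by simp
  ultimately show ?thesis by (simp add: right_descents_def)
qed

lemma ball_right_descents:
  assumes "w permutes {1..n}"
  shows "(\<forall>s\<in>right_descents n w. P s) \<longleftrightarrow>
         (\<forall>i. 1 \<le> i \<longrightarrow> i < n \<longrightarrow> w (Suc i) < w i \<longrightarrow> P (adj i))"
proof -
  have "right_descents n w = adj ` {i. 1 \<le> i \<and> i < n \<and> w (Suc i) < w i}"
  proof (intro equalityI subsetI)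
    fix s assume s: "s \<in> right_descents n w"
    then obtain i where "s = adj i" "1 \<le> i" "i < n"
      unfolding right_descents_def simple_reflections_def by auto
    then show "s \<in> adj ` {i. 1 \<le> i \<and> i < n \<and> w (Suc i) < w i}"
      using s adj_mem_right_descents[OF assms] by blast
  next
    fix s assume "s \<in> adj ` {i. 1 \<le> i \<and> i < n \<and> w (Suc i) < w i}"
    then show "s \<in> right_descents n w"
      using adj_mem_right_descents[OF assms] by blast
  qed
  then show ?thesis by (simp only: ball_simps) auto
qed

section \<open>Bruhat order\<close>

text \<open>If \<open>y = x (a b)\<close>, then \<open>ys = xs (s(a) s(b))\<close>, and \<open>s(a) < s(b)\<close> unless \<open>(a b) = s\<close>; the
  entries that are exchanged are the same as before.\<close>

lemma bruhat_step_comp_adj: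
  assumes "inj x" "bruhat_step n x y" "1 \<le> i" "i < n" "y \<noteq> x \<circ> adj i"
  shows "bruhat_step n (x \<circ> adj i) (y \<circ> adj i)"
proof -
  obtain a b where ab: "1 \<le> a" "a < b" "b \<le> n" and y: "y = x \<circ> transpose a b"
    and "perm_length n x < perm_length n y"
    using assms(2) by (auto simp: bruhat_step_def transpositions_def)
  then have lt: "x a < x b"
    using perm_length_less_comp_transpose_iff[OF assms(1) ab] by simp
  have "(a, b) \<noteq> (i, Suc i)" using y assms(5) by auto
  then have m: "adj i a < adj i b" using adj_less_mono ab by blast
  have r: "1 \<le> adj i a" "adj i b \<le> n"
    using adj_range[OF assms(3,4)] ab by auto
  have eq: "y \<circ> adj i = x \<circ> adj i \<circ> transpose (adj i a) (adj i b)"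
    using ab by (auto simp: y fun_eq_iff transpose_def)
  have "perm_length n (x \<circ> adj i) < perm_length n (x \<circ> adj i \<circ> transpose (adj i a) (adj i b))"
    by (rule perm_length_less_comp_transpose) (use m r assms(1) lt in \<open>auto simp: inj_compose\<close>)
  then show ?thesis
    using m r eq by (auto simp: bruhat_step_def transpositions_def)
qed

lemma bruhat_le_permutes:
  assumes "bruhat_le n x y" "x permutes {1..n}"
  shows "y permutes {1..n}"
  using assms unfolding bruhat_le_def
proof (induction rule: rtranclp_induct)
  case (step y z)
  from step.hyps(2) obtain a b where "1 \<le> a" "a < b" "b \<le> n" "z = y \<circ> transpose a b"
    unfolding bruhat_step_def transpositions_def by auto
  with step show ?case by (simp only: transpose_permutes less_imp_le order_trans)
qed

text \<open>A form of the lifting property: \<open>s\<close> can be pushed along a Bruhat chain until a step of the chain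
  is \<open>s\<close> itself, where it is absorbed.\<close>

lemma bruhat_le_comp_adj:
  assumes "bruhat_le n x y" "x permutes {1..n}" "1 \<le> i" "i < n"
  shows "bruhat_le n (x \<circ> adj i) y \<or> bruhat_le n (x \<circ> adj i) (y \<circ> adj i)"
  using assms(1) unfolding bruhat_le_def
proof (induction rule: rtranclp_induct)
  case (step y z)
  have "inj y"
    using bruhat_le_permutes[of n x y] step.hyps(1) assms(2) permutes_inj
    by (auto simp: bruhat_le_def)
  show ?case
  proof (cases "z = y \<circ> adj i")
    case True
    then show ?thesis using step by (metis rtranclp.rtrancl_into_rtrancl)
  next
    case False
    then show ?thesis
      using step bruhat_step_comp_adj[OF \<open>inj y\<close> step.hyps(2) assms(3,4)]
      by (metis rtranclp.rtrancl_into_rtrancl)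
  qed
qed simp

lemma bruhat_step_adj:
  assumes "1 \<le> i" "i < n" "w (Suc i) < w i"
  shows "bruhat_step n (w \<circ> adj i) w"
proof -
  have "adj i \<in> transpositions n"
    using assms by (force simp: transpositions_def)
  then show ?thesis
    using perm_length_comp_adj_down[OF assms] by (force simp: bruhat_step_def)
qed

text \<open>The two alternatives are the two ways in which a nonzero value can enter the recursion
  for \<open>R\<close>, so that this lemma makes \<open>R\<close> vanish outside the Bruhat order.\<close>

lemma bruhat_le_below_descent:
  assumes "u permutes {1..n}" "1 \<le> i" "i < n" "v (Suc i) < v i"
    and "bruhat_le n (u \<circ> adj i) (v \<circ> adj i) \<or> bruhat_le n u (v \<circ> adj i)"
  shows "bruhat_le n u v"
proof -
  have up: "bruhat_le n x v" if "bruhat_le n x (v \<circ> adj i)" for x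
    using that bruhat_step_adj[OF assms(2-4)] unfolding bruhat_le_def
    by (metis rtranclp.rtrancl_into_rtrancl)
  show ?thesis
    using assms(5)
  proof
    assume "bruhat_le n (u \<circ> adj i) (v \<circ> adj i)"
    from bruhat_le_comp_adj[OF this adj_permutes[OF assms(1-3)] assms(2,3)]
    show ?thesis using up by auto
  qed (rule up)
qed

text \<open>The base of the uniqueness proof: where the recursion says nothing about \<open>R u v\<close>, the value is
  prescribed, either by \<open>u = v\<close> or by \<open>u\<close> not lying below \<open>v\<close>.\<close>

lemma bruhat_le_eq_if_no_descent:
  assumes "bruhat_le n u v" "\<And>i. 1 \<le> i \<Longrightarrow> i < n \<Longrightarrow> v i < v (Suc i)"
  shows "u = v"
  using assms(1) perm_length_eq_0[of n v] assms(2)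
  unfolding bruhat_le_def by (auto elim: rtranclp.cases simp: bruhat_step_def)

section \<open>Existence and uniqueness of the R-polynomials\<close>

text \<open>One step of the recursion, as an operator on functions of \<open>u\<close>. Up to signs these are the
  operators by which the elements \<open>q\<close> times the inverse of \<open>T_s\<close> act on the Hecke algebra.\<close>

definition hecke_op ::
  "'a::comm_ring_1 \<Rightarrow> nat \<Rightarrow> ((nat \<Rightarrow> nat) \<Rightarrow> 'a) \<Rightarrow> (nat \<Rightarrow> nat) \<Rightarrow> 'a" where
  "hecke_op q i f u =
     (if u (Suc i) < u i then f (u \<circ> adj i) else q * f (u \<circ> adj i) + (q - 1) * f u)"

lemma hecke_op_cong:
  assumes "\<And>u. inj u \<Longrightarrow> f u = g u" "inj u"
  shows "hecke_op q i f u = hecke_op q i g u"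
  using assms by (simp add: hecke_op_def inj_compose)

lemma hecke_op_commute:
  assumes "Suc i < j"
  shows "hecke_op q i (hecke_op q j f) u = hecke_op q j (hecke_op q i f) u"
proof -
  have c: "u \<circ> adj i \<circ> adj j = u \<circ> adj j \<circ> adj i"
    using assms by (auto simp: fun_eq_iff transpose_def)
  have "(u \<circ> adj j) i = u i" "(u \<circ> adj j) (Suc i) = u (Suc i)"
    "(u \<circ> adj i) j = u j" "(u \<circ> adj i) (Suc j) = u (Suc j)"
    using assms by (auto simp: transpose_def)
  then show ?thesis
    unfolding hecke_op_def c by (auto simp: algebra_simps simp del: comp_apply)
qed

lemma adj_braid:
  "w \<circ> adj (Suc i) \<circ> adj i \<circ> adj (Suc i) = w \<circ> adj i \<circ> adj (Suc i) \<circ> adj i"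
  by (auto simp: fun_eq_iff transpose_def)

text \<open>The six relative orders of the three consecutive entries are treated separately. In each of them
  both sides become the same linear combination of values of \<open>f\<close> on the coset of \<open>u\<close> modulo
  the two reflections; injectivity of \<open>u\<close> excludes ties.\<close>

lemma hecke_op_braid:
  assumes "inj u"
  shows "hecke_op q i (hecke_op q (Suc i) (hecke_op q i f)) u =
         hecke_op q (Suc i) (hecke_op q i (hecke_op q (Suc i) f)) u"
proof -
  have "u i \<noteq> u (Suc i)" "u (Suc i) \<noteq> u (Suc (Suc i))" "u i \<noteq> u (Suc (Suc i))"
    using assms by (simp_all add: inj_eq)
  then consider "u i < u (Suc i)" "u (Suc i) < u (Suc (Suc i))"
    | "u i < u (Suc (Suc i))" "u (Suc (Suc i)) < u (Suc i)"
    | "u (Suc i) < u i" "u i < u (Suc (Suc i))"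
    | "u (Suc i) < u (Suc (Suc i))" "u (Suc (Suc i)) < u i"
    | "u (Suc (Suc i)) < u i" "u i < u (Suc i)"
    | "u (Suc (Suc i)) < u (Suc i)" "u (Suc i) < u i"
    by linarith
  then show ?thesis
    by cases (auto simp: hecke_op_def adj_braid algebra_simps simp del: comp_apply)
qed

text \<open>The values \<open>R u v\<close> for fixed \<open>v\<close>, as a function of \<open>u\<close>, computed along one particular reduced
  word of \<open>v\<close>. The least descent is just a definite choice, and \<open>R_col_descent\<close> shows that the choice
  does not matter.\<close>

function R_col :: "'a::comm_ring_1 \<Rightarrow> nat \<Rightarrow> (nat \<Rightarrow> nat) \<Rightarrow> (nat \<Rightarrow> nat) \<Rightarrow> 'a" where
  "R_col q n v =
     (if \<exists>i. 1 \<le> i \<and> i < n \<and> v (Suc i) < v i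
      then let i = (LEAST i. 1 \<le> i \<and> i < n \<and> v (Suc i) < v i)
           in hecke_op q i (R_col q n (v \<circ> adj i))
      else (\<lambda>u. if u = v then 1 else 0))"
  by auto
termination
proof (relation "Wellfounded.measure (\<lambda>(q, n, v). perm_length n v)")
  fix n :: nat and v :: "nat \<Rightarrow> nat" and i and q :: 'a
  assume ex: "\<exists>i. 1 \<le> i \<and> i < n \<and> v (Suc i) < v i"
    and i: "i = (LEAST i. 1 \<le> i \<and> i < n \<and> v (Suc i) < v i)"
  have "1 \<le> i \<and> i < n \<and> v (Suc i) < v i"
    unfolding i by (rule LeastI_ex[OF ex])
  then show "((q, n, v \<circ> adj i), (q, n, v)) \<in> Wellfounded.measure (\<lambda>(q, n, v). perm_length n v)"
    using perm_length_comp_adj_down[of i n v] by simp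
qed simp

declare R_col.simps [simp del]

text \<open>Let \<open>k < l\<close> be two descents of \<open>v\<close>. By the induction hypothesis the functions for \<open>vs_k\<close> and
  \<open>vs_l\<close> can be expanded further, until both have been traced back to \<open>v\<close> times the longest element of
  the subgroup generated by \<open>s_k\<close> and \<open>s_l\<close>. The two expansions then differ by a commutation
  or braid relation.\<close>

lemma R_col_descent:
  assumes "inj v" "1 \<le> j" "j < n" "v (Suc j) < v j" "inj u"
  shows "R_col q n v u = hecke_op q j (R_col q n (v \<circ> adj j)) u"
  using assms
proof (induction "perm_length n v" arbitrary: v j u rule: less_induct)
  case less
  let ?R = "R_col q n"
  have rec: "?R (v \<circ> adj k) x = hecke_op q l (?R (v \<circ> adj k \<circ> adj l)) x"
    if "1 \<le> k" "k < n" "v (Suc k) < v k" "1 \<le> l" "l < n"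
      "(v \<circ> adj k) (Suc l) < (v \<circ> adj k) l" "inj x" for k l x
    using less.hyps[of "v \<circ> adj k" l x] perm_length_comp_adj_down[of k n v] that less.prems(1)
    by (simp add: inj_compose del: comp_apply)
  have rec2: "?R (v \<circ> adj k \<circ> adj l) x = hecke_op q m (?R (v \<circ> adj k \<circ> adj l \<circ> adj m)) x"
    if "1 \<le> k" "k < n" "v (Suc k) < v k" "1 \<le> l" "l < n"
      "(v \<circ> adj k) (Suc l) < (v \<circ> adj k) l" "1 \<le> m" "m < n"
      "(v \<circ> adj k \<circ> adj l) (Suc m) < (v \<circ> adj k \<circ> adj l) m" "inj x" for k l m x
    using less.hyps[of "v \<circ> adj k \<circ> adj l" m x] perm_length_comp_adj_down[of k n v]
      perm_length_comp_adj_down[of l n "v \<circ> adj k"] that less.prems(1)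
    by (simp add: inj_compose del: comp_apply)
  have ordered: "hecke_op q k (?R (v \<circ> adj k)) u = hecke_op q l (?R (v \<circ> adj l)) u"
    if kl: "k < l" and k: "1 \<le> k" "k < n" "v (Suc k) < v k"
      and l: "1 \<le> l" "l < n" "v (Suc l) < v l" for k l
  proof (cases "l = Suc k")
    case False
    then have far: "Suc k < l" using kl by simp
    have v: "(v \<circ> adj k) (Suc l) < (v \<circ> adj k) l" "(v \<circ> adj l) (Suc k) < (v \<circ> adj l) k"
      using far k l by (auto simp: transpose_def)
    have c: "v \<circ> adj k \<circ> adj l = v \<circ> adj l \<circ> adj k"
      using far by (auto simp: fun_eq_iff transpose_def)
    have "hecke_op q k (?R (v \<circ> adj k)) u = hecke_op q k (hecke_op q l (?R (v \<circ> adj k \<circ> adj l))) u"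
      by (rule hecke_op_cong[OF rec less.prems(5)]) (use k l v in auto)
    also have "\<dots> = hecke_op q l (hecke_op q k (?R (v \<circ> adj l \<circ> adj k))) u"
      unfolding c by (rule hecke_op_commute[OF far])
    also have "\<dots> = hecke_op q l (?R (v \<circ> adj l)) u"
      by (rule hecke_op_cong[OF rec[symmetric] less.prems(5)]) (use k l v in auto)
    finally show ?thesis .
  next
    case True
    \<comment> \<open>The entries in positions \<open>k\<close>, \<open>k + 1\<close>, \<open>k + 2\<close> decrease, so that all prefixes of both
      words for the longest element of \<open>S\<^sub>3\<close> pass through descents.\<close>
    have tr: "v (Suc (Suc k)) < v k" using True k l by simp
    have "hecke_op q k (?R (v \<circ> adj k)) u =
      hecke_op q k (hecke_op q l (hecke_op q k (?R (v \<circ> adj k \<circ> adj l \<circ> adj k)))) u"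
    proof (intro hecke_op_cong less.prems(5))
      fix x :: "nat \<Rightarrow> nat" assume x: "inj x"
      have "?R (v \<circ> adj k) x = hecke_op q l (?R (v \<circ> adj k \<circ> adj l)) x"
        by (rule rec) (use k l tr True x in \<open>auto simp: transpose_def\<close>)
      also have "\<dots> = hecke_op q l (hecke_op q k (?R (v \<circ> adj k \<circ> adj l \<circ> adj k))) x"
        by (rule hecke_op_cong[OF rec2 x]) (use k l tr True in \<open>auto simp: transpose_def\<close>)
      finally show "?R (v \<circ> adj k) x = \<dots>" .
    qed
    also have "\<dots> = hecke_op q l (hecke_op q k (hecke_op q l (?R (v \<circ> adj l \<circ> adj k \<circ> adj l)))) u"
      using hecke_op_braid[OF less.prems(5), of q k] adj_braid[of v k] unfolding True by simp
    also have "\<dots> = hecke_op q l (?R (v \<circ> adj l)) u"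
    proof (intro hecke_op_cong less.prems(5))
      fix x :: "nat \<Rightarrow> nat" assume x: "inj x"
      have "?R (v \<circ> adj l) x = hecke_op q k (?R (v \<circ> adj l \<circ> adj k)) x"
        by (rule rec) (use k l tr True x in \<open>auto simp: transpose_def\<close>)
      also have "\<dots> = hecke_op q k (hecke_op q l (?R (v \<circ> adj l \<circ> adj k \<circ> adj l))) x"
        by (rule hecke_op_cong[OF rec2 x]) (use k l tr True in \<open>auto simp: transpose_def\<close>)
      finally show "hecke_op q k (hecke_op q l (?R (v \<circ> adj l \<circ> adj k \<circ> adj l))) x = ?R (v \<circ> adj l) x"
        by simp
    qed
    finally show ?thesis .
  qed
  let ?P = "\<lambda>i. 1 \<le> i \<and> i < n \<and> v (Suc i) < v i"
  define i where "i = (LEAST i. ?P i)"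
  have ex: "\<exists>i. ?P i" using less.prems by blast
  have i: "1 \<le> i" "i < n" "v (Suc i) < v i"
    using LeastI_ex[OF ex] unfolding i_def by auto
  have "?R v = hecke_op q i (?R (v \<circ> adj i))"
    using ex by (subst R_col.simps) (simp only: if_True Let_def i_def)
  moreover have "hecke_op q i (?R (v \<circ> adj i)) u = hecke_op q j (?R (v \<circ> adj j)) u"
    using ordered[OF _ i less.prems(2-4)] ordered[OF _ less.prems(2-4) i, symmetric]
    by (cases i j rule: linorder_cases) (assumption | simp only:)+
  ultimately show ?case by (simp only:)
qed

lemma R_col_no_descent:
  assumes "\<And>i. 1 \<le> i \<Longrightarrow> i < n \<Longrightarrow> v i < v (Suc i)"
  shows "R_col q n v u = (if u = v then 1 else 0)"
  using assms by (subst R_col.simps) (auto dest: order_less_asym)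

lemma permutation_descent_cases:
  fixes v :: "nat \<Rightarrow> nat"
  assumes "inj v"
  obtains i where "1 \<le> i" "i < n" "v (Suc i) < v i"
  | "\<And>i. 1 \<le> i \<Longrightarrow> i < n \<Longrightarrow> v i < v (Suc i)"
  using assms by (metis injD linorder_neqE_nat n_not_Suc_n)

lemma R_col_diag:
  assumes "inj v"
  shows "R_col q n v v = 1"
  using assms
proof (induction "perm_length n v" arbitrary: v rule: less_induct)
  case less
  from less.prems show ?case
  proof (cases rule: permutation_descent_cases[where n = n])
    case (1 i)
    then show ?thesis
      using less.hyps[of "v \<circ> adj i"] perm_length_comp_adj_down[OF 1]
        R_col_descent[OF less.prems 1 less.prems, of q]
        less.prems by (simp add: hecke_op_def inj_compose)
  qed (simp add: R_col_no_descent)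
qed

lemma R_col_nonzero_imp_bruhat_le:
  assumes "u permutes {1..n}" "v permutes {1..n}" "R_col q n v u \<noteq> 0"
  shows "bruhat_le n u v"
  using assms
proof (induction "perm_length n v" arbitrary: u v rule: less_induct)
  case less
  have inj: "inj u" "inj v" using less.prems permutes_inj by auto
  from inj(2) show ?case
  proof (cases rule: permutation_descent_cases[where n = n])
    case (1 i)
    have IH: "bruhat_le n x (v \<circ> adj i)"
      if "x permutes {1..n}" "R_col q n (v \<circ> adj i) x \<noteq> 0" for x
      using less.hyps[of "v \<circ> adj i" x] perm_length_comp_adj_down[OF 1]
        adj_permutes[OF less.prems(2) 1(1,2)] that by simp
    have "R_col q n (v \<circ> adj i) (u \<circ> adj i) \<noteq> 0 \<or> R_col q n (v \<circ> adj i) u \<noteq> 0"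
      using less.prems(3) R_col_descent[OF inj(2) 1 inj(1), of q]
      by (auto simp: hecke_op_def split: if_splits)
    then show ?thesis
      using IH adj_permutes[OF less.prems(1) 1(1,2)] less.prems(1)
        bruhat_le_below_descent[OF less.prems(1) 1] by blast
  next
    case 2
    then show ?thesis
      using less.prems(3) by (auto simp: R_col_no_descent bruhat_le_def split: if_splits)
  qed
qed

lemma is_R_family_iff:
  "is_R_family n R \<longleftrightarrow>
     (\<forall>u v. u permutes {1..n} \<longrightarrow> v permutes {1..n} \<longrightarrow>
        (\<not> bruhat_le n u v \<longrightarrow> R u v = 0) \<and>
        (u = v \<longrightarrow> R u v = 1) \<and>
        (\<forall>i. 1 \<le> i \<longrightarrow> i < n \<longrightarrow> v (Suc i) < v i \<longrightarrow>
           R u v = hecke_op qvar i (\<lambda>x. R x (v \<circ> adj i)) u))"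
proof -
  have "(\<forall>s \<in> right_descents n v.
           (s \<in> right_descents n u \<longrightarrow> R u v = R (u \<circ> s) (v \<circ> s)) \<and>
           (s \<notin> right_descents n u \<longrightarrow>
              R u v = qvar * R (u \<circ> s) (v \<circ> s) + (qvar - 1) * R u (v \<circ> s))) \<longleftrightarrow>
        (\<forall>i. 1 \<le> i \<longrightarrow> i < n \<longrightarrow> v (Suc i) < v i \<longrightarrow>
           R u v = hecke_op qvar i (\<lambda>x. R x (v \<circ> adj i)) u)"
    if "u permutes {1..n}" "v permutes {1..n}" for u v
    unfolding ball_right_descents[OF that(2)] hecke_op_def
    by (intro iff_allI imp_cong refl)
       (simp only: adj_mem_right_descents[OF that(1)] split: if_split, blast)
  note rec = this
  show ?thesis
    unfolding is_R_family_def by (intro iff_allI imp_cong conj_cong refl) (rule rec)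
qed

lemma is_R_family_descent:
  assumes "is_R_family n R" "u permutes {1..n}" "v permutes {1..n}"
    and "1 \<le> i" "i < n" "v (Suc i) < v i"
  shows "R u v = hecke_op qvar i (\<lambda>x. R x (v \<circ> adj i)) u"
  by (rule assms(1)[unfolded is_R_family_iff, rule_format, OF assms(2,3),
        THEN conjunct2, THEN conjunct2, rule_format, OF assms(4-6)])

lemma is_R_family_R_col: "is_R_family n (\<lambda>u v. R_col qvar n v u)"
  unfolding is_R_family_iff
proof (intro allI impI conjI)
  fix u v :: "nat \<Rightarrow> nat"
  assume u: "u permutes {1..n}" and v: "v permutes {1..n}"
  show "R_col qvar n v u = 0" if "\<not> bruhat_le n u v"
    using R_col_nonzero_imp_bruhat_le[OF u v] that by metis
  show "R_col qvar n v u = 1" if "u = v"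
    unfolding that by (rule R_col_diag[OF permutes_inj[OF v]])
  show "R_col qvar n v u = hecke_op qvar i (\<lambda>x. R_col qvar n (v \<circ> adj i) x) u"
    if "1 \<le> i" "i < n" "v (Suc i) < v i" for i
    by (rule R_col_descent[OF permutes_inj[OF v] that permutes_inj[OF u]])
qed

lemma is_R_family_unique:
  assumes "is_R_family n R" "is_R_family n R'" "u permutes {1..n}" "v permutes {1..n}"
  shows "R u v = R' u v"
  using assms(3,4)
proof (induction "perm_length n v" arbitrary: u v rule: less_induct)
  case less
  from permutes_inj[OF less.prems(2)] show ?case
  proof (cases rule: permutation_descent_cases[where n = n])
    case (1 i)
    have IH: "R x (v \<circ> adj i) = R' x (v \<circ> adj i)" if "x permutes {1..n}" for x
      using less.hyps[of "v \<circ> adj i" x] perm_length_comp_adj_down[OF 1]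
        adj_permutes[OF less.prems(2) 1(1,2)] that by simp
    show ?thesis
      using is_R_family_descent[OF assms(1) less.prems 1]
        is_R_family_descent[OF assms(2) less.prems 1] IH[OF less.prems(1)]
        IH[OF adj_permutes[OF less.prems(1) 1(1,2)]]
      by (simp add: hecke_op_def)
  next
    case 2
    then show ?thesis
      using assms(1,2) less.prems bruhat_le_eq_if_no_descent[of n u v]
      unfolding is_R_family_iff by metis
  qed
qed

lemma R_poly_eq:
  assumes "is_R_family n R" "u permutes {1..n}" "v permutes {1..n}"
  shows "R_poly n u v = R u v"
  unfolding R_poly_def
proof (rule the_equality)
  show "\<exists>R'. is_R_family n R' \<and> R' u v = R u v" by (intro exI[of _ R] conjI assms(1) refl)
next
  fix p assume "\<exists>R'. is_R_family n R' \<and> R' u v = p"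
  then obtain R' where "is_R_family n R'" "R' u v = p" by (elim exE conjE)
  then show "p = R u v" using is_R_family_unique[OF _ assms(1-3), of R'] by simp
qed

section \<open>Reduction to a simple reflection\<close>

lemma R_poly_descent:
  assumes "u permutes {1..n}" "v permutes {1..n}" "1 \<le> i" "i < n" "v (Suc i) < v i"
  shows "R_poly n u v = hecke_op qvar i (\<lambda>x. R_poly n x (v \<circ> adj i)) u"
proof -
  note R_poly = R_poly_eq[OF is_R_family_R_col]
  have "R_poly n x (v \<circ> adj i) = R_col qvar n (v \<circ> adj i) x" if "x permutes {1..n}" for x
    using that by (rule R_poly) (rule adj_permutes[OF assms(2-4)])
  from this[OF assms(1)] this[OF adj_permutes[OF assms(1,3,4)]] show ?thesis
    using is_R_family_descent[OF is_R_family_R_col assms] R_poly[OF assms(1,2)]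
    by (simp add: hecke_op_def)
qed

text \<open>If \<open>s\<close> is a descent of both permutations, this is the first case of the recursion. If it is
  a descent of neither, it is a descent of both \<open>us\<close> and \<open>vs\<close>, and the recursion is applied to these.\<close>

lemma R_poly_comp_adj:
  assumes "u permutes {1..n}" "v permutes {1..n}" "1 \<le> i" "i < n"
    and "u (Suc i) < u i \<longleftrightarrow> v (Suc i) < v i"
  shows "R_poly n (u \<circ> adj i) (v \<circ> adj i) = R_poly n u v"
proof (cases "v (Suc i) < v i")
  case True
  then show ?thesis
    using R_poly_descent[OF assms(1-4)] assms(5) by (simp add: hecke_op_def)
next
  case False
  have "u i \<noteq> u (Suc i)" "v i \<noteq> v (Suc i)"
    using permutes_inj[OF assms(1)] permutes_inj[OF assms(2)] by (simp_all add: inj_eq)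
  then show ?thesis
    using R_poly_descent[OF adj_permutes[OF assms(1,3,4)] adj_permutes[OF assms(2,3,4)] assms(3,4)]
      assms(5) False by (simp add: hecke_op_def)
qed

text \<open>If \<open>v m < v i\<close>, then minimality on \<open>[i, m]\<close> gives \<open>u m < u i < u j\<close>, and now \<open>v m > v j\<close> would
  contradict minimality on \<open>[m, j]\<close>. If \<open>v m > v i > v j\<close>, then minimality on \<open>[m, j]\<close> gives
  \<open>u m > u j\<close>.\<close>

lemma inversion_minimal_same_order:
  assumes "inj u" "inj v" "inversion_minimal n u v i j" "i < m" "m < j"
  shows "v m < v j \<and> u m < u i \<or> v i < v m \<and> u j < u m"
proof -
  have min: "\<not> (p < q \<and> {p..q} \<subset> {i..j} \<and> v p > v q \<and> u p < u q)" for p q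
    using assms(3) unfolding inversion_minimal_def by blast
  have ij: "v j < v i" "u i < u j"
    using assms(3) unfolding inversion_minimal_def by blast+
  have "{i..m} \<subset> {i..j}" "{m..j} \<subset> {i..j}" using assms(4,5) by auto
  then have "v m < v i \<Longrightarrow> \<not> u i < u m" "v j < v m \<Longrightarrow> \<not> u m < u j"
    using min[of i m] min[of m j] assms(4,5) by auto
  moreover have "u m \<noteq> u i" "u m \<noteq> u j" "v m \<noteq> v i" "v m \<noteq> v j"
    using assms(1,2,4,5) by (simp_all add: inj_eq)
  ultimately show ?thesis using ij by linarith
qed

text \<open>On the positions \<open>Suc i\<close> to \<open>j\<close>, the permutations \<open>us\<close> and \<open>vs\<close> show the entries of \<open>u\<close> and
  \<open>v\<close> in positions \<open>i\<close>, \<open>i + 2\<close>, ..., \<open>j\<close>, in this order. A smaller pair for \<open>(us, vs)\<close> would thus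
  come from a smaller pair for \<open>(u, v)\<close>.\<close>

lemma inversion_minimal_comp_adj:
  assumes "inversion_minimal n u v i j" "Suc i < j"
  shows "inversion_minimal n (u \<circ> adj i) (v \<circ> adj i) (Suc i) j"
proof -
  have min: "\<not> (p < q \<and> {p..q} \<subset> {i..j} \<and> v p > v q \<and> u p < u q)" for p q
    using assms(1) unfolding inversion_minimal_def by blast
  have ij: "1 \<le> i" "j \<le> n" "v j < v i" "u i < u j"
    using assms(1) unfolding inversion_minimal_def by blast+
  have "\<not> (v (adj i p) > v (adj i q) \<and> u (adj i p) < u (adj i q))"
    if "p < q" "{p..q} \<subset> {Suc i..j}" for p q
  proof -
    have pq: "Suc i \<le> p" "q \<le> j" "p \<noteq> Suc i \<or> q \<noteq> j" using that by auto
    then have "adj i p < adj i q" using that(1) by (auto simp: transpose_def)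
    moreover have "{adj i p..adj i q} \<subset> {i..j}"
    proof -
      have "i \<le> adj i p" "adj i q \<le> j" "adj i p \<noteq> i \<or> adj i q \<noteq> j"
        using pq that(1) assms(2) by (auto simp: transpose_def)
      then show ?thesis using \<open>adj i p < adj i q\<close> by (auto simp: atLeastatMost_psubset_iff)
    qed
    ultimately show ?thesis using min by blast
  qed
  moreover have "adj i j = j" using assms(2) by (simp add: transpose_def)
  ultimately show ?thesis
    using ij assms(2) unfolding inversion_minimal_def by (auto simp del: transpose_apply_first)
qed

theorem proposition5p3:
  fixes n i j :: nat and u v t :: "nat \<Rightarrow> nat"
  assumes "u permutes {1..n}" and "v permutes {1..n}"
    and "bruhat_le n u v"
    and "t = transpose i j"
    and "inversion_minimal n u v i j"
  shows "R_poly n u v = qvar * R_poly n (u \<circ> t) (v \<circ> t) + (qvar - 1) * R_poly n u (v \<circ> t)"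
proof -
  have "R_poly n u v = qvar * R_poly n (u \<circ> transpose i j) (v \<circ> transpose i j) +
      (qvar - 1) * R_poly n u (v \<circ> transpose i j)"
    using assms(1,2,5)
  proof (induction "j - i" arbitrary: i u v)
    case 0
    then show ?case by (simp add: inversion_minimal_def)
  next
    case (Suc d)
    note u = Suc.prems(1) and v = Suc.prems(2)
    have ij: "1 \<le> i" "i < j" "j \<le> n" "v j < v i" "u i < u j"
      using Suc.prems(3) by (auto simp: inversion_minimal_def)
    then have i: "1 \<le> i" "i < n" by auto
    show ?case
    proof (cases "j = Suc i")
      case True
      then show ?thesis
        using R_poly_descent[OF u v i] ij by (simp add: hecke_op_def)
    next
      case False
      then have far: "Suc i < j" using ij by simp
      let ?t = "transpose i j" and ?t' = "transpose (Suc i) j"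
      \<comment> \<open>\<open>s (i+1 j) = t s\<close>: this turns the induction hypothesis for \<open>(us, vs)\<close> into a statement
        about \<open>R\<close>-polynomials with all arguments multiplied by \<open>s\<close>.\<close>
      have conj: "w \<circ> adj i \<circ> ?t' = w \<circ> ?t \<circ> adj i" for w :: "nat \<Rightarrow> nat"
        using far by (auto simp: fun_eq_iff transpose_def)
      have ut: "u \<circ> ?t permutes {1..n}"
        by (rule transpose_permutes[OF u]) (use ij in simp_all)
      have vt: "v \<circ> ?t permutes {1..n}"
        by (rule transpose_permutes[OF v]) (use ij in simp_all)
      have at: "(w \<circ> ?t) i = w j" "(w \<circ> ?t) (Suc i) = w (Suc i)" for w :: "nat \<Rightarrow> nat"
        using far by (auto simp: transpose_def)
      have ord: "v (Suc i) < v j \<and> u (Suc i) < u i \<or> v i < v (Suc i) \<and> u j < u (Suc i)"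
        using inversion_minimal_same_order[OF permutes_inj[OF u] permutes_inj[OF v] Suc.prems(3)] far
        by simp
      have "R_poly n u v = R_poly n (u \<circ> adj i) (v \<circ> adj i)"
        using R_poly_comp_adj[OF u v i] ord ij by auto
      also have "\<dots> = qvar * R_poly n (u \<circ> adj i \<circ> ?t') (v \<circ> adj i \<circ> ?t') +
          (qvar - 1) * R_poly n (u \<circ> adj i) (v \<circ> adj i \<circ> ?t')"
        using Suc.hyps(1)[of "Suc i" "u \<circ> adj i" "v \<circ> adj i"] Suc.hyps(2)
          adj_permutes[OF u i] adj_permutes[OF v i] inversion_minimal_comp_adj[OF Suc.prems(3) far]
        by simp
      also have "R_poly n (u \<circ> adj i \<circ> ?t') (v \<circ> adj i \<circ> ?t') = R_poly n (u \<circ> ?t) (v \<circ> ?t)"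
        unfolding conj by (rule R_poly_comp_adj[OF ut vt i]) (use ord ij in \<open>unfold at, auto\<close>)
      also have "R_poly n (u \<circ> adj i) (v \<circ> adj i \<circ> ?t') = R_poly n u (v \<circ> ?t)"
        unfolding conj by (rule R_poly_comp_adj[OF u vt i]) (use ord ij in \<open>unfold at, auto\<close>)
      finally show ?thesis .
    qed
  qed
  then show ?thesis unfolding assms(4) .
qed

end
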